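(* Let $P=A_0+A_1D$ and $Q$ be matrix ordinary differential operators in $\mathcal{R}_\ell[D]$, where $P$ has order $1$ and its leading coefficient matrix $A_1$ is invertible. The following statements hold: 1. If there exists a common nontrivial solution, with entries in some differential field extension of $K$, of $PY=\overline{0}$ and $QY=\overline{0}$, then $\mathrm{DRes}(P,Q)=0$. 2. If $P$ and $Q$ commute and $\mathrm{DRes}(P,Q)=0$, then the matrix differential system $PY=\overline{0}$, $QY=\overline{0}$ has a nontrivial solution $\psi=(\psi_1,\dots,\psi_\ell)^t$ with every $\psi_i$ in a differential extension $\Sigma$ of $K$ of finite algebraic transcendence degree.
   Context: $K$ is a differential field with derivation $\partial$ (write $a'=\partial(a)$) whose field of constants $C$ is algebraically closed of characteristic zero. $\mathcal{R}_\ell=M_\ell(K)$ is the ring of $\ell\times\ell$ matrices over $K$, with entrywise derivation $D(A)=A'$. $\mathcal{R}_\ell[D]$ is the ring of matrix ordinary differential operators (MODOs) $\sum_j B_jD^j$, $B_j\in\mathcal{R}_\ell$, with commutation rule $DA=AD+A'$; operators act on column vectors (with entries in a differential extension of $K$) with $D$ acting entrywise. $\overline{0}=(0,\dots,0)^t$. Matrix differential resultant: for $P=A_0+A_1D$ with $A_1$ invertible and $Q=\sum_{j=0}^n B_jD^j$, $n\ge 1$, put $N=-A_1^{-1}A_0$, $p_0(N)=I_\ell$, $p_j(N)=p_{j-1}(N)N+(p_{j-1}(N))'$ for $j\ge 1$, $M(P,Q)=\sum_{j=0}^n B_jp_j(N)\in\mathcal{R}_\ell$, and $\mathrm{DRes}(P,Q)=\det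 M(P,Q)$. *)

theory Defs
  imports
    "HOL-Analysis.Analysis"
    "HOL-Algebra.Algebraic_Closure_Type"
    "HOL-Library.Poly_Mapping"
begin

section \<open>Differential fields and their extensions\<close>

definition subfield_set :: "'a::field set \<Rightarrow> bool" where
  "subfield_set S \<longleftrightarrow> 0 \<in> S \<and> 1 \<in> S \<and>
     (\<forall>x\<in>S. \<forall>y\<in>S. x + y \<in> S \<and> x * y \<in> S) \<and> (\<forall>x\<in>S. - x \<in> S \<and> inverse x \<in> S)"

definition derivation_on :: "'a::comm_ring_1 set \<Rightarrow> ('a \<Rightarrow> 'a) \<Rightarrow> bool" where
  "derivation_on S d \<longleftrightarrow> (\<forall>x\<in>S. d x \<in> S) \<and>
     (\<forall>x\<in>S. \<forall>y\<in>S. d (x + y) = d x + d y \<and> d (x * y) = d x * y + x * d y)"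

definition constants :: "('k::zero \<Rightarrow> 'k) \<Rightarrow> 'k set" where
  "constants d = {c. d c = 0}"

definition algebraically_closed_set :: "'a::field set \<Rightarrow> bool" where
  "algebraically_closed_set C \<longleftrightarrow>
     (\<forall>p. (\<forall>i. Polynomial.coeff p i \<in> C) \<and> Polynomial.degree p > 0 \<longrightarrow> (\<exists>c\<in>C. poly p c = 0))"

text \<open>
  The differential field \<open>(K, d)\<close> is a whole type. An extension of it is a subfield \<open>S\<close> of some
  field type, with a derivation \<open>\<delta>\<close> of \<open>S\<close> and an embedding \<open>\<phi>\<close> of \<open>K\<close> into \<open>S\<close>. Values of \<open>\<delta>\<close>
  outside \<open>S\<close> are irrelevant, and \<open>\<phi>\<close> is automatically injective.
\<close>

definition diff_field_extension ::
  "('k::field \<Rightarrow> 'k) \<Rightarrow> ('k \<Rightarrow> 'e::field) \<Rightarrow> 'e set \<Rightarrow> ('e \<Rightarrow> 'e) \<Rightarrow> bool" where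
  "diff_field_extension d \<phi> S \<delta> \<longleftrightarrow>
     subfield_set S \<and> derivation_on S \<delta> \<and> range \<phi> \<subseteq> S \<and> \<phi> 1 = 1 \<and>
     (\<forall>a b. \<phi> (a + b) = \<phi> a + \<phi> b \<and> \<phi> (a * b) = \<phi> a * \<phi> b) \<and>
     (\<forall>a. \<delta> (\<phi> a) = \<phi> (d a))"


section \<open>Transcendence degree\<close>

text \<open>
  A polynomial in indeterminates indexed by the elements of the field type \<open>'e\<close> is an element of
  \<open>('e \<Rightarrow>\<^sub>0 nat) \<Rightarrow>\<^sub>0 'k\<close>; \<open>eval_at_elements\<close> substitutes for every indeterminate the element that
  indexes it.
\<close>

definition eval_at_elements :: "('k::field \<Rightarrow> 'e::field) \<Rightarrow> (('e \<Rightarrow>\<^sub>0 nat) \<Rightarrow>\<^sub>0 'k) \<Rightarrow> 'e" where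
  "eval_at_elements \<phi> p =
     (\<Sum>m\<in>Poly_Mapping.keys p. \<phi> (Poly_Mapping.lookup p m) *
        (\<Prod>b\<in>Poly_Mapping.keys m. b ^ Poly_Mapping.lookup m b))"

definition algebraically_independent :: "('k::field \<Rightarrow> 'e::field) \<Rightarrow> 'e set \<Rightarrow> bool" where
  "algebraically_independent \<phi> B \<longleftrightarrow>
     (\<forall>p. (\<forall>m\<in>Poly_Mapping.keys p. Poly_Mapping.keys m \<subseteq> B) \<and> eval_at_elements \<phi> p = 0 \<longrightarrow> p = 0)"

definition algebraic_over :: "'e::field set \<Rightarrow> 'e \<Rightarrow> bool" where
  "algebraic_over F x \<longleftrightarrow> (\<exists>p. p \<noteq> 0 \<and> (\<forall>i. Polynomial.coeff p i \<in> F) \<and> poly p x = 0)"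

definition generated_subfield :: "'e::field set \<Rightarrow> 'e set" where
  "generated_subfield A = \<Inter> {F. subfield_set F \<and> A \<subseteq> F}"

definition transcendence_basis :: "('k::field \<Rightarrow> 'e::field) \<Rightarrow> 'e set \<Rightarrow> 'e set \<Rightarrow> bool" where
  "transcendence_basis \<phi> S B \<longleftrightarrow>
     B \<subseteq> S \<and> algebraically_independent \<phi> B \<and>
     (\<forall>x\<in>S. algebraic_over (generated_subfield (range \<phi> \<union> B)) x)"

definition finite_transcendence_degree :: "('k::field \<Rightarrow> 'e::field) \<Rightarrow> 'e set \<Rightarrow> bool" where
  "finite_transcendence_degree \<phi> S \<longleftrightarrow> (\<exists>B. finite B \<and> transcendence_basis \<phi> S B)"

text \<open>
  One cannot quantify existentially over types. The algebraic closure of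
  \<open>K(x\<^sub>0, x\<^sub>1, x\<^sub>2, \<dots>)\<close> contains a copy, over \<open>K\<close>, of every field extension of \<open>K\<close> of finite
  transcendence degree, so asserting the existence of such an extension inside this type loses and
  adds nothing.
\<close>

type_synonym 'k universal_ext = "((nat \<Rightarrow>\<^sub>0 nat) \<Rightarrow>\<^sub>0 'k) fract alg_closure"


section \<open>Matrix ordinary differential operators\<close>

text \<open>
  \<open>\<Sum>\<^sub>j B\<^sub>j D\<^sup>j\<close>, coefficients on the left, is stored as the \<open>poly\<close> with coefficients \<open>B\<^sub>j\<close>. Only the
  additive structure of \<open>poly\<close> is used: its product, and \<open>*\<close> on \<open>'k^'n^'n\<close> (which is
  componentwise), play no role. The product of operators is \<open>modo_mult\<close>.
\<close>

type_synonym ('k, 'n) modo = "('k^'n^'n) poly"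

text \<open>\<open>D (\<Sum>\<^sub>j B\<^sub>j D\<^sup>j) = \<Sum>\<^sub>j B\<^sub>j D\<^sup>j\<^sup>+\<^sup>1 + \<Sum>\<^sub>j B\<^sub>j' D\<^sup>j\<close>, by \<open>D A = A D + A'\<close>.\<close>

definition D_times :: "('k::field \<Rightarrow> 'k) \<Rightarrow> ('k, 'n::finite) modo \<Rightarrow> ('k, 'n) modo" where
  "D_times d Q = pCons 0 Q + map_poly (map_matrix d) Q"

definition modo_mult ::
  "('k::field \<Rightarrow> 'k) \<Rightarrow> ('k, 'n::finite) modo \<Rightarrow> ('k, 'n) modo \<Rightarrow> ('k, 'n) modo" where
  "modo_mult d P Q =
     (\<Sum>i\<le>Polynomial.degree P. map_poly (\<lambda>B. Polynomial.coeff P i ** B) ((D_times d ^^ i) Q))"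

lemma D_times_matrix:
  assumes "derivation_on UNIV d"
  shows "modo_mult d (Polynomial.monom (mat 1) 1) [:A:]
           = modo_mult d [:A:] (Polynomial.monom (mat 1) 1) + [:map_matrix d A:]"
proof -
  have d0: "d 0 = 0"
    using assms unfolding derivation_on_def by (metis UNIV_I add_cancel_right_left)
  have d1: "d 1 = 0"
    using assms unfolding derivation_on_def by (metis UNIV_I add_cancel_right_left mult_1 mult_1_right)
  have m0: "map_matrix d 0 = 0" and m1: "map_matrix d (mat 1) = 0"
    by (simp_all add: map_matrix_def mat_def vec_eq_iff d0 d1)
  have nz: "mat 1 \<noteq> (0 :: 'a^'b^'b)"
    by (simp add: mat_def vec_eq_iff)
  have deg: "Polynomial.degree (Polynomial.monom (mat 1 :: 'a^'b^'b) 1) = 1"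
    using nz by (rule degree_monom_eq)
  show ?thesis
    unfolding modo_mult_def deg
    by (rule poly_eqI)
      (auto simp: D_times_def coeff_map_poly m0 m1 coeff_pCons atMost_Suc d0 split: nat.splits)
qed

definition map_vector :: "('a \<Rightarrow> 'b) \<Rightarrow> 'a^'n \<Rightarrow> 'b^'n" where
  "map_vector f y = (\<chi> i. f (y $ i))"

definition modo_apply ::
  "('k::field \<Rightarrow> 'e::field) \<Rightarrow> ('e \<Rightarrow> 'e) \<Rightarrow> ('k, 'n::finite) modo \<Rightarrow> 'e^'n \<Rightarrow> 'e^'n" where
  "modo_apply \<phi> \<delta> Q y =
     (\<Sum>j\<le>Polynomial.degree Q. map_matrix \<phi> (Polynomial.coeff Q j) *v ((map_vector \<delta> ^^ j) y))"

text \<open>\<open>y\<close> is a solution with entries in \<open>S\<close> of \<open>P Y = 0\<close>, \<open>Q Y = 0\<close>, not identically zero.\<close>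

definition nontrivial_common_solution ::
  "('k::field \<Rightarrow> 'e::field) \<Rightarrow> 'e set \<Rightarrow> ('e \<Rightarrow> 'e) \<Rightarrow>
     ('k, 'n::finite) modo \<Rightarrow> ('k, 'n) modo \<Rightarrow> 'e^'n \<Rightarrow> bool" where
  "nontrivial_common_solution \<phi> S \<delta> P Q y \<longleftrightarrow>
     (\<forall>i. y $ i \<in> S) \<and> y \<noteq> 0 \<and> modo_apply \<phi> \<delta> P y = 0 \<and> modo_apply \<phi> \<delta> Q y = 0"


section \<open>The matrix differential resultant\<close>

fun p_seq :: "('k::field \<Rightarrow> 'k) \<Rightarrow> 'k^'n::finite^'n \<Rightarrow> nat \<Rightarrow> 'k^'n^'n" where
  "p_seq d N 0 = mat 1"
| "p_seq d N (Suc j) = p_seq d N j ** N + map_matrix d (p_seq d N j)"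

text \<open>\<open>P\<close> is meant to be \<open>A\<^sub>0 + A\<^sub>1 D\<close> with \<open>A\<^sub>1\<close> invertible.\<close>

definition M_matrix ::
  "('k::field \<Rightarrow> 'k) \<Rightarrow> ('k, 'n::finite) modo \<Rightarrow> ('k, 'n) modo \<Rightarrow> 'k^'n^'n" where
  "M_matrix d P Q =
     (let N = - (matrix_inv (Polynomial.coeff P 1) ** Polynomial.coeff P 0)
      in \<Sum>j\<le>Polynomial.degree Q. Polynomial.coeff Q j ** p_seq d N j)"

definition DRes :: "('k::field \<Rightarrow> 'k) \<Rightarrow> ('k, 'n::finite) modo \<Rightarrow> ('k, 'n) modo \<Rightarrow> 'k" where
  "DRes d P Q = det (M_matrix d P Q)"

end

theory Submission
  imports Defs
begin

text \<open>
  Put \<open>N = - A\<^sub>1\<inverse> A\<^sub>0\<close> and \<open>M = M(P,Q)\<close>. On solutions of \<open>Y' = N Y\<close>, that is of \<open>P Y = 0\<close>, the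
  operator \<open>Q\<close> acts as the matrix \<open>M\<close>, so a nonzero common solution lies in the kernel of \<open>M\<close>.
  Conversely, commutation of \<open>P\<close> and \<open>Q\<close> amounts, modulo the left ideal of \<open>D - N\<close>, to
  \<open>M' = N M - M N\<close>, which says that \<open>D - N\<close> maps the kernel of \<open>M\<close> to itself. If \<open>W\<close> is a
  projection onto this kernel, then \<open>W' - N W = W B\<close> with \<open>B = W' - N W\<close>. Adjoin indeterminates
  \<open>z\<^sub>1, \<dots>, z\<^sub>\<ell>\<close> to \<open>K\<close> with \<open>z' = - B z\<close>; then \<open>\<psi> = W z\<close> satisfies \<open>\<psi>' = N \<psi>\<close> and
  \<open>M \<psi> = 0\<close>, and it is nonzero because \<open>W\<close> is.
\<close>

section \<open>Derivations and matrices\<close>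

lemma derivation_on_0: "derivation_on S d \<Longrightarrow> 0 \<in> S \<Longrightarrow> d 0 = 0"
  unfolding derivation_on_def by (metis add_cancel_right_left)

lemma derivation_on_1: "derivation_on S d \<Longrightarrow> 1 \<in> S \<Longrightarrow> d 1 = 0"
  unfolding derivation_on_def by (metis add_cancel_right_left mult_1 mult_1_right)

lemma subfield_set_sum: "subfield_set S \<Longrightarrow> (\<And>i. i \<in> A \<Longrightarrow> f i \<in> S) \<Longrightarrow> sum f A \<in> S"
  by (induction A rule: infinite_finite_induct) (auto simp: subfield_set_def)

lemma derivation_on_sum:
  assumes "subfield_set S" "derivation_on S d"
  shows "(\<And>i. i \<in> A \<Longrightarrow> f i \<in> S) \<Longrightarrow> d (sum f A) = (\<Sum>i\<in>A. d (f i))"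
proof (induction A rule: infinite_finite_induct)
  case (insert a A)
  then have "d (f a + sum f A) = d (f a) + d (sum f A)"
    using assms subfield_set_sum[OF assms(1), of A f] unfolding derivation_on_def by blast
  with insert show ?case
    by simp
qed (use assms derivation_on_0 in \<open>auto simp: subfield_set_def\<close>)

lemma subfield_set_UNIV: "subfield_set UNIV"
  by (simp add: subfield_set_def)

lemma map_matrix_derivation_mult:
  fixes A B :: "'k::field^'n::finite^'n"
  assumes "derivation_on UNIV d"
  shows "map_matrix d (A ** B) = map_matrix d A ** B + A ** map_matrix d B"
proof -
  have "d (\<Sum>k\<in>UNIV. f k * g k) = (\<Sum>k\<in>UNIV. d (f k) * g k) + (\<Sum>k\<in>UNIV. f k * d (g k))"
    for f g :: "'n \<Rightarrow> 'k"
  proof -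
    have "d (\<Sum>k\<in>UNIV. f k * g k) = (\<Sum>k\<in>UNIV. d (f k * g k))"
      by (rule derivation_on_sum[OF subfield_set_UNIV assms]) simp
    moreover have "d (f k * g k) = d (f k) * g k + f k * d (g k)" for k
      using assms by (simp add: derivation_on_def)
    ultimately show ?thesis
      by (simp add: sum.distrib)
  qed
  then show ?thesis
    by (simp add: vec_eq_iff matrix_matrix_mult_def)
qed

lemma map_matrix_derivation_add:
  assumes "derivation_on UNIV d"
  shows "map_matrix d (A + B) = map_matrix d A + map_matrix d B"
  using assms by (simp add: vec_eq_iff derivation_on_def)

lemma map_matrix_derivation_0: "derivation_on UNIV d \<Longrightarrow> map_matrix d 0 = 0"
  using derivation_on_0[of UNIV d] by (simp add: vec_eq_iff)

lemma map_matrix_derivation_sum: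
  assumes "derivation_on UNIV d"
  shows "map_matrix d (sum f A) = (\<Sum>i\<in>A. map_matrix d (f i))"
  by (induction A rule: infinite_finite_induct)
    (simp_all add: map_matrix_derivation_0 map_matrix_derivation_add assms)

lemma matrix_add_mult_distrib: "(B + C) ** A = B ** A + C ** (A :: 'a::semiring_1^_^_)"
  by (simp add: vec_eq_iff matrix_matrix_mult_def algebra_simps sum.distrib)

lemma matrix_mult_minus: "(- A) ** B = - (A ** B)" "A ** (- B) = - (A ** (B :: 'a::ring_1^_^_))"
  by (simp_all add: vec_eq_iff matrix_matrix_mult_def sum_negf)

lemma matrix_sum_rdistrib: "sum f I ** A = (\<Sum>i\<in>I. f i ** (A :: 'a::semiring_1^_^_))"
  by (induction I rule: infinite_finite_induct) (simp_all add: matrix_add_mult_distrib)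

lemma matrix_sum_ldistrib: "A ** sum f I = (\<Sum>i\<in>I. (A :: 'a::semiring_1^_^_) ** f i)"
  by (induction I rule: infinite_finite_induct) (simp_all add: matrix_add_ldistrib)


section \<open>Evaluation of operators modulo \<open>D - N\<close>\<close>

text \<open>The remainder of \<open>Q\<close> under right division by \<open>D - N\<close>. Modulo
  the left ideal of \<open>D - N\<close>, the power D^j is congruent to p_j, since D p_j = p_j D +
  p_j' is congruent to p_j N + p_j'. For N = -A_1^{-1} A_0 this is M(P,Q).\<close>

definition modo_eval :: "('k::field \<Rightarrow> 'k) \<Rightarrow> 'k^'n::finite^'n \<Rightarrow> ('k, 'n) modo \<Rightarrow> 'k^'n^'n" where
  "modo_eval d N Q = (\<Sum>j\<le>Polynomial.degree Q. Polynomial.coeff Q j ** p_seq d N j)"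

lemma modo_eval_upto:
  assumes "Polynomial.degree Q \<le> n"
  shows "modo_eval d N Q = (\<Sum>j\<le>n. Polynomial.coeff Q j ** p_seq d N j)"
  unfolding modo_eval_def
  by (rule sum.mono_neutral_left) (use assms in \<open>auto simp: coeff_eq_0\<close>)

lemma modo_eval_add: "modo_eval d N (P + Q) = modo_eval d N P + modo_eval d N Q"
proof -
  let ?n = "max (Polynomial.degree P) (Polynomial.degree Q)"
  have "Polynomial.degree (P + Q) \<le> ?n"
    by (rule degree_add_le) auto
  then show ?thesis
    by (simp add: modo_eval_upto[of _ ?n] matrix_add_mult_distrib sum.distrib)
qed

lemma modo_eval_sum: "modo_eval d N (sum f A) = (\<Sum>i\<in>A. modo_eval d N (f i))"
proof (induction A rule: infinite_finite_induct)
  case (insert a A)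
  then show ?case by (simp add: modo_eval_add)
qed (simp_all add: modo_eval_def)

lemma modo_eval_mult_left: "modo_eval d N (map_poly (\<lambda>B. A ** B) Q) = A ** modo_eval d N Q"
proof -
  have "modo_eval d N (map_poly (\<lambda>B. A ** B) Q)
      = (\<Sum>j\<le>Polynomial.degree Q. Polynomial.coeff (map_poly (\<lambda>B. A ** B) Q) j ** p_seq d N j)"
    by (rule modo_eval_upto) (simp add: map_poly_degree_leq)
  then show ?thesis
    by (simp add: coeff_map_poly modo_eval_def matrix_sum_ldistrib matrix_mul_assoc)
qed

text \<open>If Y is the remainder of Q, then D Q is congruent to D Y = Y D + Y', hence to Y N + Y'.
  On coefficients, the shifted part gives B_j p_{j+1} = B_j p_j N + B_j p_j', the differentiated
  part gives B_j' p_j, and the Leibniz rule collects the derivatives.\<close>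

lemma modo_eval_D_times:
  assumes d: "derivation_on UNIV d"
  shows "modo_eval d N (D_times d Q) = modo_eval d N Q ** N + map_matrix d (modo_eval d N Q)"
proof -
  let ?n = "Polynomial.degree Q"
  have m0: "map_matrix d 0 = 0"
    using d by (rule map_matrix_derivation_0)
  have "modo_eval d N (pCons 0 Q)
      = (\<Sum>j\<le>Suc ?n. Polynomial.coeff (pCons 0 Q) j ** p_seq d N j)"
    by (rule modo_eval_upto) (simp add: degree_pCons_le)
  also have "\<dots> = (\<Sum>j\<le>?n. Polynomial.coeff Q j ** p_seq d N (Suc j))"
    by (subst sum.atMost_Suc_shift) simp
  finally have 1: "modo_eval d N (pCons 0 Q)
      = (\<Sum>j\<le>?n. Polynomial.coeff Q j ** p_seq d N (Suc j))" .
  have 2: "modo_eval d N (map_poly (map_matrix d) Q)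
      = (\<Sum>j\<le>?n. map_matrix d (Polynomial.coeff Q j) ** p_seq d N j)"
    by (subst modo_eval_upto[of _ ?n]) (simp_all add: map_poly_degree_leq coeff_map_poly m0)
  show ?thesis
    unfolding D_times_def modo_eval_add 1 2
    unfolding modo_eval_def
    by (simp add: matrix_sum_rdistrib map_matrix_derivation_sum[OF d]
        map_matrix_derivation_mult[OF d] matrix_add_ldistrib sum.distrib matrix_mul_assoc add_ac)
qed

text \<open>The remainder of a product depends on the right factor only through its remainder. In
  particular, a right factor with remainder 0 makes the whole product have remainder 0.\<close>

lemma modo_eval_modo_mult:
  assumes "derivation_on UNIV d"
  shows "modo_eval d N (modo_mult d P Q)
    = (\<Sum>i\<le>Polynomial.degree P. Polynomial.coeff P i **
         ((\<lambda>Y. Y ** N + map_matrix d Y) ^^ i) (modo_eval d N Q))"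
proof -
  have "modo_eval d N ((D_times d ^^ i) Q)
      = ((\<lambda>Y. Y ** N + map_matrix d Y) ^^ i) (modo_eval d N Q)" for i
    by (induction i) (simp_all add: modo_eval_D_times assms)
  then show ?thesis
    by (simp add: modo_mult_def modo_eval_sum modo_eval_mult_left)
qed

section \<open>First-order operators, commutation, and the kernel of a singular matrix\<close>

lemma degree_first_order:
  fixes A\<^sub>0 A\<^sub>1 :: "'k::field^'n::finite^'n"
  assumes "invertible A\<^sub>1"
  shows "Polynomial.degree [:A\<^sub>0, A\<^sub>1:] = 1"
proof -
  have "(mat 1 :: 'k^'n^'n) $ undefined $ undefined \<noteq> 0"
    by (simp add: mat_def)
  then have "(mat 1 :: 'k^'n^'n) \<noteq> 0"
    by (metis zero_index)
  with assms have "A\<^sub>1 \<noteq> 0"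
    by (auto simp: invertible_def)
  then show ?thesis
    by simp
qed

lemma matrix_inv_mult:
  fixes A :: "'k::field^'n::finite^'n"
  assumes "invertible A"
  shows "A ** matrix_inv A = mat 1" "matrix_inv A ** A = mat 1"
  using someI_ex[OF assms[unfolded invertible_def]] by (simp_all add: matrix_inv_def)

text \<open>
  Since \<open>P\<close> lies in the left ideal of \<open>D - N\<close>, so does \<open>Q P\<close>; hence \<open>P Q\<close> does, and
  its value modulo \<open>D - N\<close> is \<open>A\<^sub>1 (M N + M' - N M)\<close>.
\<close>
lemma commuting_first_order:
  fixes A\<^sub>0 A\<^sub>1 :: "'k::field^'n::finite^'n"
  assumes d: "derivation_on UNIV d"
    and inv: "invertible A\<^sub>1"
    and com: "modo_mult d [:A\<^sub>0, A\<^sub>1:] Q = modo_mult d Q [:A\<^sub>0, A\<^sub>1:]"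
    and N: "N = - (matrix_inv A\<^sub>1 ** A\<^sub>0)"
  shows "modo_eval d N Q ** N + map_matrix d (modo_eval d N Q) = N ** modo_eval d N Q"
proof -
  let ?P = "[:A\<^sub>0, A\<^sub>1:]" and ?M = "modo_eval d N Q"
  let ?f = "\<lambda>Y :: 'k^'n^'n. Y ** N + map_matrix d Y"
  note deg = degree_first_order[OF inv, of A\<^sub>0]
  have A1N: "A\<^sub>1 ** N = - A\<^sub>0"
    by (simp add: N matrix_mult_minus matrix_mul_assoc matrix_inv_mult[OF inv])
  have m1: "map_matrix d (mat 1) = 0"
    using derivation_on_0[OF d] derivation_on_1[OF d] by (simp add: vec_eq_iff mat_def)
  have P0: "modo_eval d N ?P = 0"
    unfolding modo_eval_def deg by (simp add: A1N m1)
  have "(?f ^^ i) 0 = 0" for i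
    by (induction i) (simp_all add: map_matrix_derivation_0[OF d])
  then have "modo_eval d N (modo_mult d Q ?P) = 0"
    by (simp add: modo_eval_modo_mult[OF d] P0)
  moreover have "modo_eval d N (modo_mult d ?P Q) = A\<^sub>0 ** ?M + A\<^sub>1 ** ?f ?M"
    unfolding modo_eval_modo_mult[OF d] deg by simp
  ultimately have "A\<^sub>0 ** ?M + A\<^sub>1 ** ?f ?M = 0"
    using com by simp
  then have "matrix_inv A\<^sub>1 ** (A\<^sub>0 ** ?M + A\<^sub>1 ** ?f ?M) = 0"
    by simp
  then have "- (N ** ?M) + ?f ?M = 0"
    by (simp only: matrix_add_ldistrib matrix_mul_assoc matrix_inv_mult[OF inv] N
        matrix_mult_minus matrix_mul_lid minus_minus)
  then show ?thesis
    by (simp add: algebra_simps)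
qed

text \<open>A generalized inverse G with M G M = M exists over every field, and W = 1 - G M is then
  a projection onto the kernel of M. If W were 0, G would be a left inverse of M, which det M = 0
  forbids.\<close>

lemma singular_kernel_projection:
  fixes M :: "'k::field^'n::finite^'n"
  assumes "det M = 0"
  obtains W where "W \<noteq> 0" "M ** W = 0" "\<And>Y :: 'k^'n^'n. M ** Y = 0 \<Longrightarrow> W ** Y = Y"
proof -
  have "Vector_Spaces.linear (*s) (*s) ((*v) M)"
    by simp
  then obtain g where g: "Vector_Spaces.linear (*s) (*s) g" "\<And>v. M *v g (M *v v) = M *v v"
    using vec.linear_exists_right_inverse_on[of "(*v) M" UNIV] by auto
  define G where "G = matrix g"
  define W where "W = mat 1 - G ** M"
  have G: "G *v v = g v" for v
    using matrix_works[OF g(1)] by (simp add: G_def)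
  have "M ** (G ** M) = M"
    by (simp add: matrix_eq g(2) G flip: matrix_vector_mul_assoc)
  then have "M ** W = 0"
    using matrix_add_ldistrib[of M W "G ** M"] by (simp add: W_def)
  moreover have WY: "W ** Y = Y" if "M ** Y = 0" for Y :: "'k^'n^'n"
    using matrix_add_mult_distrib[of W "G ** M" Y] that
    by (simp add: W_def flip: matrix_mul_assoc)
  moreover have "W \<noteq> 0"
  proof
    assume "W = 0"
    then have "G ** M = mat 1"
      by (simp add: W_def)
    then have "det G * det M = 1"
      by (metis det_I det_mul)
    with assms show False
      by simp
  qed
  ultimately show ?thesis
    using that by blast
qed


section \<open>Operators acting on an extension\<close>

lemma diff_field_extension_0: "diff_field_extension d \<phi> S \<delta> \<Longrightarrow> \<phi> 0 = 0"
  unfolding diff_field_extension_def by (metis add_cancel_right_left)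

lemma diff_field_extension_sum:
  "diff_field_extension d \<phi> S \<delta> \<Longrightarrow> \<phi> (sum f A) = (\<Sum>i\<in>A. \<phi> (f i))"
  by (induction A rule: infinite_finite_induct)
    (simp_all add: diff_field_extension_0, simp add: diff_field_extension_def)

lemma diff_field_extension_eq_0_iff:
  assumes "diff_field_extension d \<phi> S \<delta>"
  shows "\<phi> a = 0 \<longleftrightarrow> a = 0"
proof
  assume a: "\<phi> a = 0"
  show "a = 0"
  proof (rule ccontr)
    assume "a \<noteq> 0"
    then have "\<phi> a * \<phi> (inverse a) = \<phi> 1"
      using assms unfolding diff_field_extension_def by (metis right_inverse)
    with a assms show False
      by (simp add: diff_field_extension_def)
  qed
qed (simp add: diff_field_extension_0[OF assms])

lemma diff_field_extension_mult_vec: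
  assumes "diff_field_extension d \<phi> S \<delta>"
  shows "map_matrix \<phi> A *v (map_matrix \<phi> B *v y) = map_matrix \<phi> (A ** B) *v y"
proof -
  have "map_matrix \<phi> (A ** B) = map_matrix \<phi> A ** map_matrix \<phi> B"
    using assms
    by (simp add: vec_eq_iff matrix_matrix_mult_def diff_field_extension_sum[OF assms])
      (simp add: diff_field_extension_def)
  then show ?thesis
    by (simp add: matrix_vector_mul_assoc)
qed

lemma diff_field_extension_add_vec:
  assumes "diff_field_extension d \<phi> S \<delta>"
  shows "map_matrix \<phi> (A + B) *v y = map_matrix \<phi> A *v y + map_matrix \<phi> B *v y"
  using assms
  by (simp add: vec_eq_iff matrix_vector_mult_def algebra_simps sum.distrib diff_field_extension_def)

lemma diff_field_extension_zero_vec: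
  assumes "diff_field_extension d \<phi> S \<delta>"
  shows "map_matrix \<phi> 0 *v y = 0"
  by (simp add: vec_eq_iff matrix_vector_mult_def diff_field_extension_0[OF assms])

lemma diff_field_extension_sum_vec:
  assumes "diff_field_extension d \<phi> S \<delta>"
  shows "map_matrix \<phi> (sum f I) *v y = (\<Sum>i\<in>I. map_matrix \<phi> (f i) *v y)"
  by (induction I rule: infinite_finite_induct)
    (simp_all add: diff_field_extension_zero_vec[OF assms] diff_field_extension_add_vec[OF assms])

lemma diff_field_extension_matrix_vec_closed:
  fixes y :: "'e::field^'n::finite"
  assumes "diff_field_extension d \<phi> S \<delta>" "\<And>i. y $ i \<in> S"
  shows "(map_matrix \<phi> A *v y) $ i \<in> S"
proof -
  have "\<phi> a * y $ j \<in> S" for a j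
    using assms unfolding diff_field_extension_def subfield_set_def by blast
  then show ?thesis
    using assms(1) unfolding diff_field_extension_def
    by (auto simp: matrix_vector_mult_def intro!: subfield_set_sum)
qed

lemma map_vector_matrix_vec:
  fixes y :: "'e::field^'n::finite"
  assumes ext: "diff_field_extension d \<phi> S \<delta>" and y: "\<And>i. y $ i \<in> S"
  shows "map_vector \<delta> (map_matrix \<phi> A *v y)
    = map_matrix \<phi> (map_matrix d A) *v y + map_matrix \<phi> A *v map_vector \<delta> y"
proof -
  \<comment> \<open>\<open>\<delta>\<close> obeys the sum and product rules only on
    \<open>S\<close>, so each summand must first be placed there.\<close>
  have mem: "\<phi> a * y $ j \<in> S" for a j
    using ext y unfolding diff_field_extension_def subfield_set_def by blast
  have "\<delta> (\<phi> a * y $ j) = \<phi> (d a) * y $ j + \<phi> a * \<delta> (y $ j)" for a j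
  proof -
    have "\<phi> a \<in> S"
      using ext unfolding diff_field_extension_def by blast
    then have "\<delta> (\<phi> a * y $ j) = \<delta> (\<phi> a) * y $ j + \<phi> a * \<delta> (y $ j)"
      using ext y unfolding diff_field_extension_def derivation_on_def by blast
    then show ?thesis
      using ext by (simp add: diff_field_extension_def)
  qed
  moreover have "\<delta> (\<Sum>j\<in>UNIV. \<phi> (f j) * y $ j) = (\<Sum>j\<in>UNIV. \<delta> (\<phi> (f j) * y $ j))" for f
    by (rule derivation_on_sum[of S]) (use ext mem in \<open>auto simp: diff_field_extension_def\<close>)
  ultimately show ?thesis
    by (simp add: vec_eq_iff map_vector_def matrix_vector_mult_def sum.distrib)
qed

text \<open>Differentiating y' = N y repeatedly gives y^(j) = p_j(N) y, because (p_j y)' = p_j' y +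
  p_j N y is the recursion of \<open>p_seq\<close>.\<close>

lemma modo_apply_solution:
  fixes y :: "'e::field^'n::finite"
  assumes ext: "diff_field_extension d \<phi> S \<delta>" and y: "\<And>i. y $ i \<in> S"
    and sol: "map_vector \<delta> y = map_matrix \<phi> N *v y"
  shows "modo_apply \<phi> \<delta> Q y = map_matrix \<phi> (modo_eval d N Q) *v y"
proof -
  have mat1: "map_matrix \<phi> (mat 1) = mat 1"
    using ext by (simp add: vec_eq_iff mat_def diff_field_extension_0[OF ext])
      (simp add: diff_field_extension_def)
  have "(map_vector \<delta> ^^ j) y = map_matrix \<phi> (p_seq d N j) *v y" for j
  proof (induction j)
    case (Suc j)
    then show ?case
      by (simp add: map_vector_matrix_vec[OF ext y] sol diff_field_extension_mult_vec[OF ext]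
          diff_field_extension_add_vec[OF ext])
  qed (simp add: mat1)
  then show ?thesis
    by (simp add: modo_apply_def modo_eval_def diff_field_extension_mult_vec[OF ext]
        diff_field_extension_sum_vec[OF ext])
qed

lemma modo_apply_first_order_eq_0_iff:
  assumes ext: "diff_field_extension d \<phi> S \<delta>"
    and inv: "invertible A\<^sub>1"
    and N: "N = - (matrix_inv A\<^sub>1 ** A\<^sub>0)"
  shows "modo_apply \<phi> \<delta> [:A\<^sub>0, A\<^sub>1:] y = 0 \<longleftrightarrow> map_vector \<delta> y = map_matrix \<phi> N *v y"
proof -
  let ?L = "map_matrix \<phi> A\<^sub>0 *v y + map_matrix \<phi> A\<^sub>1 *v map_vector \<delta> y"
  have mat1: "map_matrix \<phi> (mat 1) = mat 1"
    using ext by (simp add: vec_eq_iff mat_def diff_field_extension_0[OF ext])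
      (simp add: diff_field_extension_def)
  have A1N: "A\<^sub>0 + A\<^sub>1 ** N = 0"
    by (simp add: N matrix_mult_minus matrix_mul_assoc matrix_inv_mult[OF inv])
  have ivN: "matrix_inv A\<^sub>1 ** A\<^sub>0 + N = 0"
    by (simp add: N)
  have L: "modo_apply \<phi> \<delta> [:A\<^sub>0, A\<^sub>1:] y = ?L"
    unfolding modo_apply_def degree_first_order[OF inv] by simp
  \<comment> \<open>Multiplying the equation by the inverse of A_1 solves it for y'; the converse
    uses A_0 + A_1 N = 0.\<close>
  have "map_vector \<delta> y = map_matrix \<phi> N *v y" if "?L = 0"
  proof -
    have "map_matrix \<phi> (matrix_inv A\<^sub>1) *v ?L = 0"
      using that by simp
    then have "map_matrix \<phi> (matrix_inv A\<^sub>1 ** A\<^sub>0) *v y + map_vector \<delta> y = 0"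
      by (simp add: matrix_vector_right_distrib diff_field_extension_mult_vec[OF ext]
          matrix_inv_mult[OF inv] mat1)
    moreover have "map_matrix \<phi> (matrix_inv A\<^sub>1 ** A\<^sub>0) *v y + map_matrix \<phi> N *v y = 0"
      using diff_field_extension_add_vec[OF ext, of "matrix_inv A\<^sub>1 ** A\<^sub>0" N y] ivN
      by (simp add: diff_field_extension_zero_vec[OF ext])
    ultimately show ?thesis
      by (metis add_left_imp_eq)
  qed
  moreover have "?L = 0" if "map_vector \<delta> y = map_matrix \<phi> N *v y"
    using diff_field_extension_add_vec[OF ext, of A\<^sub>0 "A\<^sub>1 ** N" y] A1N that
    by (simp add: diff_field_extension_zero_vec[OF ext] diff_field_extension_mult_vec[OF ext])
  ultimately show ?thesis
    unfolding L by blast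
qed

lemma det_map_matrix:
  assumes "diff_field_extension d \<phi> S \<delta>"
  shows "det (map_matrix \<phi> A) = \<phi> (det A)"
proof -
  have prod: "\<phi> (prod f I) = (\<Prod>i\<in>I. \<phi> (f i))" for f :: "'c \<Rightarrow> 'a" and I
    by (induction I rule: infinite_finite_induct)
      (use assms in \<open>simp_all add: diff_field_extension_def\<close>)
  have uminus: "\<phi> (- x) = - \<phi> x" for x
    using assms diff_field_extension_0[OF assms]
    unfolding diff_field_extension_def by (metis add.right_inverse add_eq_0_iff)
  have sign: "\<phi> (of_int (sign p)) = of_int (sign p)" for p :: "'c \<Rightarrow> 'c"
    using assms by (simp add: sign_def uminus) (simp add: diff_field_extension_def)
  have "\<phi> (a * b) = \<phi> a * \<phi> b" for a b
    using assms by (simp add: diff_field_extension_def)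
  then show ?thesis
    by (simp add: det_def diff_field_extension_sum[OF assms] prod sign)
qed


section \<open>A generic solution of a linear system\<close>

text \<open>The quotient rule forces the extension. \<open>\<Delta>\<close> takes values in the
  field rather than in the ring, so that derivatives of indeterminates may themselves be
  fractions.\<close>

lemma derivation_extends_to_fractions:
  fixes \<iota> :: "'r::idom \<Rightarrow> 'e::field" and \<Delta> :: "'r \<Rightarrow> 'e"
  assumes hom: "\<And>a b. \<iota> (a + b) = \<iota> a + \<iota> b" "\<And>a b. \<iota> (a * b) = \<iota> a * \<iota> b" "\<iota> 1 = 1"
    and inj: "inj \<iota>"
    and \<Delta>: "\<And>a b. \<Delta> (a + b) = \<Delta> a + \<Delta> b" "\<And>a b. \<Delta> (a * b) = \<Delta> a * \<iota> b + \<iota> a * \<Delta> b"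
  shows "\<exists>\<delta>. (\<forall>a. \<delta> (\<iota> a) = \<Delta> a) \<and>
    (\<forall>x\<in>{\<iota> a / \<iota> b | a b. b \<noteq> 0}. \<forall>y\<in>{\<iota> a / \<iota> b | a b. b \<noteq> 0}.
       \<delta> (x + y) = \<delta> x + \<delta> y \<and> \<delta> (x * y) = \<delta> x * y + x * \<delta> y)"
proof -
  define q where "q a b = (\<Delta> a * \<iota> b - \<iota> a * \<Delta> b) / (\<iota> b * \<iota> b)" for a b
  define \<delta> where "\<delta> x = (SOME z. \<exists>a b. b \<noteq> 0 \<and> x = \<iota> a / \<iota> b \<and> z = q a b)" for x
  have \<iota>0: "\<iota> 0 = 0"
    using hom(1) by (metis add_cancel_right_left)
  have nz: "\<iota> b \<noteq> 0" if "b \<noteq> 0" for b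
    using injD[OF inj, of b 0] \<iota>0 that by auto
  \<comment> \<open>The quotient rule does not depend on the chosen representation, so the choice
    made in \<open>\<delta>\<close> is harmless.\<close>
  have wd: "q a b = q a' b'" if "b \<noteq> 0" "b' \<noteq> 0" "\<iota> a / \<iota> b = \<iota> a' / \<iota> b'" for a b a' b'
  proof -
    have e: "\<iota> a * \<iota> b' = \<iota> a' * \<iota> b"
      using that nz by (simp add: field_simps)
    then have "a * b' = a' * b"
      by (intro injD[OF inj]) (simp add: hom)
    then have \<Delta>e: "\<Delta> a * \<iota> b' + \<iota> a * \<Delta> b' = \<Delta> a' * \<iota> b + \<iota> a' * \<Delta> b"
      by (metis \<Delta>(2))
    \<comment> \<open>The cross-multiplied difference is a combination of the relation a b' = a' b
      and its derivative, and both vanish.\<close>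
    have "(\<Delta> a * \<iota> b - \<iota> a * \<Delta> b) * (\<iota> b' * \<iota> b') - (\<Delta> a' * \<iota> b' - \<iota> a' * \<Delta> b') * (\<iota> b * \<iota> b)
        = \<iota> b * \<iota> b' * ((\<Delta> a * \<iota> b' + \<iota> a * \<Delta> b') - (\<Delta> a' * \<iota> b + \<iota> a' * \<Delta> b))
          - (\<iota> a * \<iota> b' - \<iota> a' * \<iota> b) * (\<Delta> b' * \<iota> b + \<Delta> b * \<iota> b')"
      by (simp add: algebra_simps)
    then have "(\<Delta> a * \<iota> b - \<iota> a * \<Delta> b) * (\<iota> b' * \<iota> b')
        = (\<Delta> a' * \<iota> b' - \<iota> a' * \<Delta> b') * (\<iota> b * \<iota> b)"
      using e \<Delta>e by simp
    then show ?thesis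
      using nz that by (simp add: q_def frac_eq_eq)
  qed
  have \<delta>: "\<delta> (\<iota> a / \<iota> b) = q a b" if "b \<noteq> 0" for a b
  proof -
    have "\<exists>a' b'. b' \<noteq> 0 \<and> \<iota> a / \<iota> b = \<iota> a' / \<iota> b' \<and> \<delta> (\<iota> a / \<iota> b) = q a' b'"
      unfolding \<delta>_def by (rule someI_ex) (use that in blast)
    then show ?thesis
      using wd[OF that] by metis
  qed
  have "\<Delta> 1 = 0"
    using \<Delta>(2)[of 1 1] hom(3) by (metis add_cancel_right_left mult_1 mult_1_right)
  then have "\<delta> (\<iota> a) = \<Delta> a" for a
    using \<delta>[of 1 a] by (simp add: q_def hom)
  moreover have "\<delta> (x + y) = \<delta> x + \<delta> y \<and> \<delta> (x * y) = \<delta> x * y + x * \<delta> y"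
    if xy: "x \<in> {\<iota> a / \<iota> b | a b. b \<noteq> 0}" "y \<in> {\<iota> a / \<iota> b | a b. b \<noteq> 0}" for x y
  proof -
    obtain a b a' b' where x: "x = \<iota> a / \<iota> b" "b \<noteq> 0" and y: "y = \<iota> a' / \<iota> b'" "b' \<noteq> 0"
      using xy by blast
    have "x + y = \<iota> (a * b' + a' * b) / \<iota> (b * b')" "x * y = \<iota> (a * a') / \<iota> (b * b')"
      using x y nz by (simp_all add: hom add_frac_eq)
    then have "\<delta> (x + y) = q (a * b' + a' * b) (b * b')" "\<delta> (x * y) = q (a * a') (b * b')"
      using x y \<delta> by simp_all
    moreover have "q (a * b' + a' * b) (b * b') = q a b + q a' b'"
      using x(2) y(2) nz by (simp add: q_def hom \<Delta> field_simps)
    moreover have "q (a * a') (b * b') = q a b * (\<iota> a' / \<iota> b') + \<iota> a / \<iota> b * q a' b'"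
      using x(2) y(2) nz by (simp add: q_def hom \<Delta> field_simps)
    moreover have "\<delta> x = q a b" "\<delta> y = q a' b'"
      using x y \<delta> by simp_all
    ultimately show ?thesis
      using x(1) y(1) by simp
  qed
  ultimately show ?thesis
    by blast
qed

lemma poly_mapping_sum_single:
  "p = (\<Sum>m\<in>Poly_Mapping.keys p. Poly_Mapping.single m (Poly_Mapping.lookup p m))"
  by (rule poly_mapping_eqI)
    (auto simp: lookup_sum lookup_single when_def in_keys_iff sum.delta)

text \<open>
  The derivation with \<open>x\<^sub>i' = x\<^sub>i g\<^sub>i\<close>, where the logarithmic derivative \<open>m \<mapsto> \<Sum>\<^sub>i m\<^sub>i g\<^sub>i\<close> of a monomial
  is an arbitrary additive map \<open>L\<close>.
\<close>
lemma derivation_of_polynomials: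
  fixes \<iota> :: "(('i::linorder \<Rightarrow>\<^sub>0 nat) \<Rightarrow>\<^sub>0 'k::field) \<Rightarrow> 'e::field" and L :: "('i \<Rightarrow>\<^sub>0 nat) \<Rightarrow> 'e"
  assumes d: "derivation_on UNIV d"
    and hom: "\<And>a b. \<iota> (a + b) = \<iota> a + \<iota> b" "\<And>a b. \<iota> (a * b) = \<iota> a * \<iota> b"
    and L: "\<And>m m'. L (m + m') = L m + L m'"
  shows "\<exists>\<Delta>. (\<forall>a b. \<Delta> (a + b) = \<Delta> a + \<Delta> b) \<and>
    (\<forall>a b. \<Delta> (a * b) = \<Delta> a * \<iota> b + \<iota> a * \<Delta> b) \<and>
    (\<forall>m c. \<Delta> (Poly_Mapping.single m c)
       = \<iota> (Poly_Mapping.single m (d c)) + \<iota> (Poly_Mapping.single m c) * L m)"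
proof -
  \<comment> \<open>The derivative of the single term c x^m, with x^m differentiated through its
    logarithmic derivative \<open>L m\<close>.\<close>
  define t where "t m c = \<iota> (Poly_Mapping.single m (d c)) + \<iota> (Poly_Mapping.single m c) * L m" for m c
  define \<Delta> where "\<Delta> p = (\<Sum>m\<in>Poly_Mapping.keys p. t m (Poly_Mapping.lookup p m))" for p
  have dadd: "d (a + b) = d a + d b" and dmult: "d (a * b) = d a * b + a * d b" for a b
    using d by (auto simp: derivation_on_def)
  have d0: "d 0 = 0"
    using derivation_on_0[OF d] by simp
  have \<iota>0: "\<iota> 0 = 0"
    using hom(1) by (metis add_cancel_right_left)
  have t0: "t m 0 = 0" for m
    by (simp add: t_def d0 \<iota>0)
  have tadd: "t m (a + b) = t m a + t m b" for m a b
    by (simp add: t_def dadd hom single_add algebra_simps)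
  \<comment> \<open>Since \<open>t m 0 = 0\<close>, the sum may run over any finite set containing
    the support; this allows cancellation of terms in \<open>a + b\<close>.\<close>
  have upto: "\<Delta> p = (\<Sum>m\<in>A. t m (Poly_Mapping.lookup p m))"
    if "Poly_Mapping.keys p \<subseteq> A" "finite A" for p A
    unfolding \<Delta>_def
    by (rule sum.mono_neutral_left) (use that in \<open>auto simp: t0 in_keys_iff\<close>)
  have add: "\<Delta> (a + b) = \<Delta> a + \<Delta> b" for a b
  proof -
    let ?A = "Poly_Mapping.keys a \<union> Poly_Mapping.keys b"
    have "Poly_Mapping.keys (a + b) \<subseteq> ?A"
      by (rule keys_add)
    then show ?thesis
      by (simp add: upto[of _ ?A] lookup_add tadd sum.distrib)
  qed
  have single: "\<Delta> (Poly_Mapping.single m c) = t m c" for m c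
    by (simp add: upto[of _ "{m}"])
  have \<Delta>0: "\<Delta> 0 = 0"
    by (simp add: \<Delta>_def)
  have \<Delta>sum: "\<Delta> (sum f A) = (\<Sum>i\<in>A. \<Delta> (f i))" for f and A :: "('i \<Rightarrow>\<^sub>0 nat) set"
    by (induction A rule: infinite_finite_induct) (simp_all add: \<Delta>0 add)
  have \<iota>sum: "\<iota> (sum f A) = (\<Sum>i\<in>A. \<iota> (f i))" for f and A :: "('i \<Rightarrow>\<^sub>0 nat) set"
    by (induction A rule: infinite_finite_induct) (simp_all add: \<iota>0 hom)
  let ?s = Poly_Mapping.single
  \<comment> \<open>On single terms exponents add, so the product rule is additivity of
    \<open>L\<close> together with the product rule for \<open>d\<close>. Expanding one factor at a
    time then gives it for all polynomials.\<close>
  have mult1: "\<Delta> (?s m a * ?s n b) = \<Delta> (?s m a) * \<iota> (?s n b) + \<iota> (?s m a) * \<Delta> (?s n b)" for m n a b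
  proof -
    have *: "\<iota> (?s (m + n) (x * y)) = \<iota> (?s m x) * \<iota> (?s n y)" for x y
      by (simp add: mult_single flip: hom)
    have "\<Delta> (?s m a * ?s n b) = \<iota> (?s m (d a)) * \<iota> (?s n b) + \<iota> (?s m a) * \<iota> (?s n (d b))
        + \<iota> (?s m a) * \<iota> (?s n b) * (L m + L n)"
      by (simp only: single mult_single t_def dmult single_add hom(1) L *)
    then show ?thesis
      by (simp add: single t_def algebra_simps)
  qed
  have mult2: "\<Delta> (?s m a * q) = \<Delta> (?s m a) * \<iota> q + \<iota> (?s m a) * \<Delta> q" for m a q
    by (subst (1 2 3) poly_mapping_sum_single[of q])
      (simp add: sum_distrib_left \<Delta>sum \<iota>sum mult1 sum.distrib)
  have "\<Delta> (p * q) = \<Delta> p * \<iota> q + \<iota> p * \<Delta> q" for p q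
    by (subst (1 2 3) poly_mapping_sum_single[of p])
      (simp add: sum_distrib_right \<Delta>sum \<iota>sum mult2 sum.distrib)
  with add single show ?thesis
    unfolding t_def by blast
qed

section \<open>Generated subfields and algebraic independence of indeterminates\<close>

lemma generated_subfield_subset: "A \<subseteq> generated_subfield A"
  by (auto simp: generated_subfield_def)

lemma subfield_set_generated_subfield: "subfield_set (generated_subfield A)"
  by (auto simp: generated_subfield_def subfield_set_def)

lemma generated_subfield_least: "subfield_set F \<Longrightarrow> A \<subseteq> F \<Longrightarrow> generated_subfield A \<subseteq> F"
  by (auto simp: generated_subfield_def)

text \<open>Only closure under \<open>\<delta>\<close> is at stake. By the sum, product and inverse
  rules, the elements whose derivative stays in the generated subfield form a subfield containing
  the generators, so minimality makes it everything.\<close>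

lemma derivation_on_generated_subfield:
  assumes F: "subfield_set F" and A: "A \<subseteq> F"
    and add: "\<And>x y. x \<in> F \<Longrightarrow> y \<in> F \<Longrightarrow> \<delta> (x + y) = \<delta> x + \<delta> y"
    and mult: "\<And>x y. x \<in> F \<Longrightarrow> y \<in> F \<Longrightarrow> \<delta> (x * y) = \<delta> x * y + x * \<delta> y"
    and gen: "\<And>x. x \<in> A \<Longrightarrow> \<delta> x \<in> generated_subfield A"
  shows "derivation_on (generated_subfield A) \<delta>"
proof -
  let ?S = "generated_subfield A"
  let ?T = "{x \<in> ?S. \<delta> x \<in> ?S}"
  have SF: "?S \<subseteq> F"
    by (rule generated_subfield_least[OF F A])
  have S: "subfield_set ?S"
    by (rule subfield_set_generated_subfield)
  have F0: "0 \<in> F" "1 \<in> F"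
    using F by (auto simp: subfield_set_def)
  have z: "\<delta> 0 = 0"
    using add[OF F0(1) F0(1)] by (metis add_cancel_right_left)
  have o: "\<delta> 1 = 0"
    using mult[OF F0(2) F0(2)] by (metis add_cancel_right_left mult_1 mult_1_right)
  have um: "\<delta> (- x) = - \<delta> x" if "x \<in> F" for x
    using add[of x "- x"] F that z by (simp add: subfield_set_def eq_neg_iff_add_eq_0 add.commute)
  have iv: "\<delta> (inverse x) = - (\<delta> x * inverse x * inverse x)" if "x \<in> F" for x
  proof (cases "x = 0")
    case False
    have "inverse x \<in> F"
      using F that by (simp add: subfield_set_def)
    then have "\<delta> x * inverse x + x * \<delta> (inverse x) = 0"
      using mult[of x "inverse x"] that o False by simp
    then have "x * \<delta> (inverse x) = - (\<delta> x * inverse x)"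
      by (simp add: eq_neg_iff_add_eq_0 add.commute)
    then show ?thesis
      using False by (simp add: field_simps)
  qed (simp add: z)
  have "subfield_set ?T"
    using S SF z o um iv add mult unfolding subfield_set_def by (auto simp: subset_iff)
  moreover have "A \<subseteq> ?T"
    using gen generated_subfield_subset by blast
  ultimately have "?S \<subseteq> ?T"
    by (rule generated_subfield_least)
  moreover have "\<delta> (x + y) = \<delta> x + \<delta> y" "\<delta> (x * y) = \<delta> x * y + x * \<delta> y"
    if "x \<in> ?S" "y \<in> ?S" for x y
    using add mult that SF by (meson subsetD)+
  ultimately show ?thesis
    unfolding derivation_on_def by (simp add: subset_iff)
qed

text \<open>Renaming each element \<open>x i\<close> back to the index \<open>i\<close> turns a
  relation among the elements into a polynomial whose image under \<open>\<iota>\<close> is the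
  value of the relation. Injectivity of \<open>\<iota>\<close> makes that polynomial zero.\<close>

lemma algebraically_independent_indeterminates:
  fixes \<iota> :: "(('i::linorder \<Rightarrow>\<^sub>0 nat) \<Rightarrow>\<^sub>0 'k::field) \<Rightarrow> 'e::field"
  assumes hom: "\<And>a b. \<iota> (a + b) = \<iota> a + \<iota> b" "\<And>a b. \<iota> (a * b) = \<iota> a * \<iota> b" "\<iota> 1 = 1"
    and inj: "inj \<iota>"
    and x: "\<And>i. x i = \<iota> (Poly_Mapping.single (Poly_Mapping.single i 1) 1)" "inj x"
    and B: "B \<subseteq> range x"
  shows "algebraically_independent (\<lambda>c. \<iota> (Poly_Mapping.single 0 c)) B"
  unfolding algebraically_independent_def
proof (intro allI impI, elim conjE)
  fix p :: "('e \<Rightarrow>\<^sub>0 nat) \<Rightarrow>\<^sub>0 'k"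
  let ?s = Poly_Mapping.single
  let ?h = "Poly_Mapping.map_key x"
  assume keys: "\<forall>m\<in>Poly_Mapping.keys p. Poly_Mapping.keys m \<subseteq> B"
    and ev: "eval_at_elements (\<lambda>c. \<iota> (?s 0 c)) p = 0"
  have \<iota>0: "\<iota> 0 = 0"
    using hom(1) by (metis add_cancel_right_left)
  have \<iota>sum: "\<iota> (sum f A) = (\<Sum>i\<in>A. \<iota> (f i))" for f and A :: "('e \<Rightarrow>\<^sub>0 nat) set"
    by (induction A rule: infinite_finite_induct) (simp_all add: \<iota>0 hom)
  have \<iota>prod: "\<iota> (prod f A) = (\<Prod>i\<in>A. \<iota> (f i))" for f and A :: "'i set"
    by (induction A rule: infinite_finite_induct) (simp_all add: hom)
  have \<iota>pow: "\<iota> (a ^ n) = \<iota> a ^ n" for a n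
    by (induction n) (simp_all add: hom)
  have single_sum: "?s (sum f A) (1::'k) = (\<Prod>i\<in>A. ?s (f i) 1)"
    for f :: "'i \<Rightarrow> 'i \<Rightarrow>\<^sub>0 nat" and A
  proof (induction A rule: infinite_finite_induct)
    case (insert a A)
    have "?s (f a + sum f A) (1::'k) = ?s (f a) 1 * ?s (sum f A) 1"
      by (simp add: mult_single)
    with insert show ?case
      by simp
  qed simp_all
  have single_pow: "?s (?s i n) (1::'k) = ?s (?s i 1) 1 ^ n" for i :: 'i and n
  proof (induction n)
    case (Suc n)
    have "?s (?s i (Suc n)) (1::'k) = ?s (?s i 1) 1 * ?s (?s i n) 1"
      by (simp add: mult_single flip: single_add)
    with Suc show ?case
      by simp
  qed simp
  \<comment> \<open>A monomial in the elements is the image of the monomial with pulled-back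
    exponents \<open>?h m\<close>; its keys lie in the range of \<open>x\<close>, so no factor is
    lost.\<close>
  have monomial: "(\<Prod>b\<in>Poly_Mapping.keys m. b ^ Poly_Mapping.lookup m b) = \<iota> (?s (?h m) 1)"
    if "m \<in> Poly_Mapping.keys p" for m
  proof -
    have "Poly_Mapping.keys m \<subseteq> range x"
      using keys B that by blast
    then have k: "Poly_Mapping.keys m = x ` Poly_Mapping.keys (?h m)"
      by (auto simp: keys_map_key[OF x(2)])
    have "?s (?h m) (1::'k)
        = (\<Prod>i\<in>Poly_Mapping.keys (?h m). ?s (?s i 1) 1 ^ Poly_Mapping.lookup (?h m) i)"
    proof -
      have "?s (?h m) (1::'k)
          = ?s (\<Sum>i\<in>Poly_Mapping.keys (?h m). ?s i (Poly_Mapping.lookup (?h m) i)) 1"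
        by (rule arg_cong[OF poly_mapping_sum_single])
      then show ?thesis
        unfolding single_sum by (simp only: single_pow[symmetric])
    qed
    then have "\<iota> (?s (?h m) 1)
        = (\<Prod>i\<in>Poly_Mapping.keys (?h m). x i ^ Poly_Mapping.lookup m (x i))"
      by (simp add: \<iota>prod \<iota>pow x(1)[symmetric] map_key.rep_eq[OF x(2)] del: One_nat_def)
    also have "\<dots> = (\<Prod>b\<in>Poly_Mapping.keys m. b ^ Poly_Mapping.lookup m b)"
      unfolding k using x(2) by (subst prod.reindex) (auto intro: inj_on_subset)
    finally show ?thesis
      by simp
  qed
  define P where "P = (\<Sum>m\<in>Poly_Mapping.keys p. ?s (?h m) (Poly_Mapping.lookup p m))"
  have "\<iota> P = (\<Sum>m\<in>Poly_Mapping.keys p. \<iota> (?s 0 (Poly_Mapping.lookup p m) * ?s (?h m) 1))"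
    by (simp add: P_def \<iota>sum mult_single)
  also have "\<dots> = eval_at_elements (\<lambda>c. \<iota> (?s 0 c)) p"
    unfolding eval_at_elements_def by (intro sum.cong) (simp_all add: hom monomial)
  finally have P0: "P = 0"
    using ev injD[OF inj, of P 0] \<iota>0 by simp
  \<comment> \<open>Distinct monomials of \<open>p\<close> stay distinct after renaming, so the
    terms of \<open>P\<close> cannot merge and each coefficient of \<open>p\<close> can be read off
    from \<open>P\<close>.\<close>
  have hinj: "m = m'" if "m \<in> Poly_Mapping.keys p" "m' \<in> Poly_Mapping.keys p" "?h m = ?h m'" for m m'
  proof (rule poly_mapping_eqI)
    fix b
    show "Poly_Mapping.lookup m b = Poly_Mapping.lookup m' b"
    proof (cases "b \<in> range x")
      case True
      then obtain i where "b = x i" by blast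
      then show ?thesis
        using arg_cong[OF that(3), of "\<lambda>q. Poly_Mapping.lookup q i"]
        by (simp add: map_key.rep_eq[OF x(2)])
    next
      case False
      then have "b \<notin> Poly_Mapping.keys m" "b \<notin> Poly_Mapping.keys m'"
        using keys B that by blast+
      then show ?thesis
        by (simp add: in_keys_iff)
    qed
  qed
  have "m \<notin> Poly_Mapping.keys p" for m
  proof
    assume m: "m \<in> Poly_Mapping.keys p"
    have "Poly_Mapping.lookup P (?h m)
        = (\<Sum>m'\<in>Poly_Mapping.keys p. if m' = m then Poly_Mapping.lookup p m' else 0)"
      unfolding P_def lookup_sum
      by (intro sum.cong) (use hinj m in \<open>auto simp: lookup_single when_def\<close>)
    then have "Poly_Mapping.lookup p m = 0"
      using m P0 by simp
    then show False
      using m by (simp add: in_keys_iff)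
  qed
  then show "p = 0"
    by (metis all_not_in_conv keys_eq_empty)
qed

lemma algebraic_over_member:
  assumes "subfield_set F" "x \<in> F"
  shows "algebraic_over F x"
  unfolding algebraic_over_def
  by (rule exI[of _ "[:- x, 1:]"])
    (use assms in \<open>auto simp: coeff_pCons subfield_set_def split: nat.splits\<close>)

section \<open>The differential field generated by a generic solution\<close>

text \<open>The entries of \<open>z\<close> are distinct indeterminates, whose derivatives may be
  prescribed freely as \<open>B z\<close>. Their linear independence over K gives the last claim,
  which later keeps the constructed solution nonzero.\<close>

lemma generic_solution:
  fixes d :: "'k::field \<Rightarrow> 'k" and B :: "'k^'n::finite^'n"
  assumes d: "derivation_on UNIV d"
  obtains \<phi> :: "'k \<Rightarrow> 'k universal_ext" and \<Sigma> \<delta> and z :: "'k universal_ext^'n" where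
    "diff_field_extension d \<phi> \<Sigma> \<delta>" "finite_transcendence_degree \<phi> \<Sigma>" "\<And>i. z $ i \<in> \<Sigma>"
    "map_vector \<delta> z = map_matrix \<phi> B *v z"
    "\<And>A :: 'k^'n^'n. map_matrix \<phi> A *v z = 0 \<Longrightarrow> A = 0"
proof -
  let ?s = Poly_Mapping.single
  define \<iota> :: "((nat \<Rightarrow>\<^sub>0 nat) \<Rightarrow>\<^sub>0 'k) \<Rightarrow> 'k universal_ext" where "\<iota> p = to_ac (Fract p 1)" for p
  have hom: "\<iota> (a + b) = \<iota> a + \<iota> b" "\<iota> (a * b) = \<iota> a * \<iota> b" "\<iota> 1 = 1" for a b
    by (simp_all add: \<iota>_def flip: to_ac_add to_ac_mult One_fract_def)
  have inj: "inj \<iota>"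
    by (rule injI) (simp add: \<iota>_def eq_fract)
  have \<iota>0: "\<iota> 0 = 0"
    by (simp add: \<iota>_def flip: Zero_fract_def)
  have \<iota>_eq_0: "a = 0" if "\<iota> a = 0" for a
    using injD[OF inj, of a 0] \<iota>0 that by simp
  have \<iota>sum: "\<iota> (sum f I) = (\<Sum>i\<in>I. \<iota> (f i))" for f and I :: "'n set"
    by (induction I rule: infinite_finite_induct) (simp_all add: \<iota>0 hom)
  define x where "x i = \<iota> (?s (?s i 1) 1)" for i
  define \<phi> where "\<phi> c = \<iota> (?s 0 c)" for c
  have \<phi>: "\<phi> (a + b) = \<phi> a + \<phi> b" "\<phi> (a * b) = \<phi> a * \<phi> b" "\<phi> 1 = 1" for a b
    by (simp_all add: \<phi>_def single_add hom(1,3) mult_single flip: hom(2))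
  have xinj: "inj x"
  proof (rule injI)
    fix i j assume "x i = x j"
    then have "?s (?s i (1::nat)) (1::'k) = ?s (?s j 1) 1"
      unfolding x_def by (rule injD[OF inj])
    then have "?s i (1::nat) = ?s j 1"
      by (metis lookup_single_eq lookup_single_not_eq zero_neq_one)
    then show "i = j"
      by (metis lookup_single_eq lookup_single_not_eq zero_neq_one)
  qed
  have xnz: "x i \<noteq> 0" for i
  proof
    assume "x i = 0"
    then have "?s (?s i (1::nat)) (1::'k) = 0"
      unfolding x_def by (rule \<iota>_eq_0)
    then show False
      by (metis lookup_single_eq lookup_zero zero_neq_one)
  qed
  \<comment> \<open>The universal extension has countably many indeterminates; \<open>e\<close>
    selects one for each coordinate.\<close>
  obtain e :: "'n \<Rightarrow> nat" where e: "inj e"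
    using finite_imp_inj_to_nat_seg[of "UNIV :: 'n set"] by auto
  define z where "z = (\<chi> i. x (e i))"
  \<comment> \<open>Logarithmic derivatives: the weight (B z)_i / z_i makes the derivative of z_i
    equal (B z)_i. Indeterminates outside the range of \<open>e\<close> receive weight 0.\<close>
  define L where "L m = (\<Sum>i\<in>UNIV. of_nat (Poly_Mapping.lookup m (e i)) *
      ((map_matrix \<phi> B *v z) $ i / x (e i)))" for m
  have L: "L (m + m') = L m + L m'" for m m'
    by (simp add: L_def lookup_add algebra_simps add_divide_distrib sum.distrib)
  obtain \<Delta> where "\<forall>a b. \<Delta> (a + b) = \<Delta> a + \<Delta> b"
    "\<forall>a b. \<Delta> (a * b) = \<Delta> a * \<iota> b + \<iota> a * \<Delta> b"
    "\<forall>m c. \<Delta> (?s m c) = \<iota> (?s m (d c)) + \<iota> (?s m c) * L m"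
    using derivation_of_polynomials[OF d hom(1,2) L] by (elim exE conjE)
  then have \<Delta>: "\<Delta> (a + b) = \<Delta> a + \<Delta> b" "\<Delta> (a * b) = \<Delta> a * \<iota> b + \<iota> a * \<Delta> b"
    "\<Delta> (?s m c) = \<iota> (?s m (d c)) + \<iota> (?s m c) * L m" for a b m c
    by simp_all
  let ?F = "{\<iota> a / \<iota> b | a b. b \<noteq> 0}"
  obtain \<delta> where \<delta>: "\<forall>a. \<delta> (\<iota> a) = \<Delta> a"
    "\<forall>x\<in>?F. \<forall>y\<in>?F. \<delta> (x + y) = \<delta> x + \<delta> y \<and> \<delta> (x * y) = \<delta> x * y + x * \<delta> y"
    using derivation_extends_to_fractions[OF hom inj \<Delta>(1,2)] by (elim exE conjE)
  have F: "?F = range to_ac"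
  proof -
    have quot: "\<iota> a / \<iota> b = to_ac (Fract a b)" for a b
      by (simp add: \<iota>_def flip: to_ac_divide)
    have "to_ac f \<in> ?F" for f
    proof -
      obtain a b where f: "f = Fract a b" "b \<noteq> 0"
        by (cases f) auto
      have "to_ac f = \<iota> a / \<iota> b"
        by (simp only: f(1) quot)
      with f(2) show ?thesis
        by blast
    qed
    moreover have "?F \<subseteq> range to_ac"
      by clarify (simp only: quot rangeI)
    ultimately show ?thesis
      by blast
  qed
  let ?R = "range to_ac :: 'k universal_ext set"
  have \<delta>_add: "\<delta> (u + v) = \<delta> u + \<delta> v" and \<delta>_mult: "\<delta> (u * v) = \<delta> u * v + u * \<delta> v"
    if "u \<in> ?R" "v \<in> ?R" for u v
    using \<delta>(2)[unfolded F] that by blast+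
  have R: "subfield_set ?R"
    unfolding subfield_set_def
  proof (intro conjI ballI)
    show "0 \<in> range to_ac" "1 \<in> range to_ac"
      by (metis rangeI to_ac_0, metis rangeI to_ac_1)
  qed (auto simp flip: to_ac_add to_ac_mult to_ac_minus to_ac_inverse)
  have \<iota>F: "\<iota> a \<in> ?R" for a
    by (simp add: \<iota>_def)
  have d1: "d 1 = 0"
    using derivation_on_1[OF d] by simp
  have \<delta>\<phi>: "\<delta> (\<phi> c) = \<phi> (d c)" for c
    by (simp add: \<phi>_def \<delta>(1)[rule_format] \<Delta>(3) L_def)
  have \<delta>x: "\<delta> (x (e i)) = (map_matrix \<phi> B *v z) $ i" for i
  proof -
    have "L (?s (e i) 1) = (\<Sum>j\<in>UNIV. if j = i then (map_matrix \<phi> B *v z) $ j / x (e j) else 0)"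
      unfolding L_def using e by (intro sum.cong) (auto simp: lookup_single when_def inj_eq)
    then have "L (?s (e i) 1) = (map_matrix \<phi> B *v z) $ i / x (e i)"
      by simp
    then have "\<delta> (x (e i)) = x (e i) * ((map_matrix \<phi> B *v z) $ i / x (e i))"
      using \<delta>(1)[rule_format, of "?s (?s (e i) 1) 1"] by (simp add: \<Delta>(3) d1 \<iota>0 x_def)
    then show ?thesis
      using xnz by simp
  qed
  \<comment> \<open>Only the selected indeterminates are adjoined, which keeps the transcendence
    degree finite; \<open>V\<close> itself is the transcendence basis.\<close>
  define V where "V = range (\<lambda>i. x (e i))"
  define \<Sigma> where "\<Sigma> = generated_subfield (range \<phi> \<union> V)"
  have \<Sigma>: "subfield_set \<Sigma>" "range \<phi> \<union> V \<subseteq> \<Sigma>"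
    unfolding \<Sigma>_def by (rule subfield_set_generated_subfield generated_subfield_subset)+
  have zS: "z $ i \<in> \<Sigma>" for i
    using \<Sigma> by (auto simp: z_def V_def)
  have BzS: "(map_matrix \<phi> B *v z) $ i \<in> \<Sigma>" for i
  proof -
    have "\<phi> a * z $ j \<in> \<Sigma>" for a j
      using \<Sigma> zS unfolding subfield_set_def by blast
    then show ?thesis
      by (auto simp: matrix_vector_mult_def intro!: subfield_set_sum[OF \<Sigma>(1)])
  qed
  have der: "derivation_on \<Sigma> \<delta>"
    unfolding \<Sigma>_def
  proof (rule derivation_on_generated_subfield[OF R _ \<delta>_add \<delta>_mult])
    show "range \<phi> \<union> V \<subseteq> ?R"
      using \<iota>F by (auto simp: \<phi>_def V_def x_def)
    show "\<delta> y \<in> generated_subfield (range \<phi> \<union> V)" if "y \<in> range \<phi> \<union> V" for y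
    proof -
      have "\<phi> c \<in> \<Sigma>" for c
        using \<Sigma>(2) by blast
      then have "\<delta> y \<in> \<Sigma>"
        using that BzS by (auto simp: V_def \<delta>\<phi> \<delta>x)
      then show ?thesis
        by (simp only: \<Sigma>_def)
    qed
  qed
  have ext: "diff_field_extension d \<phi> \<Sigma> \<delta>"
    unfolding diff_field_extension_def
    using \<Sigma> der \<delta>\<phi> \<phi> by auto
  moreover have "finite_transcendence_degree \<phi> \<Sigma>"
    unfolding finite_transcendence_degree_def transcendence_basis_def
  proof (intro exI conjI ballI)
    show "finite V" "V \<subseteq> \<Sigma>"
      using \<Sigma>(2) by (auto simp: V_def)
    show "algebraically_independent \<phi> V"
      unfolding \<phi>_def
      by (rule algebraically_independent_indeterminates[OF hom inj x_def xinj]) (auto simp: V_def)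
    show "algebraic_over (generated_subfield (range \<phi> \<union> V)) y" if "y \<in> \<Sigma>" for y
      using \<Sigma>(1) that unfolding \<Sigma>_def by (rule algebraic_over_member)
  qed
  moreover have "map_vector \<delta> z = map_matrix \<phi> B *v z"
    by (simp add: vec_eq_iff map_vector_def z_def) (simp add: \<delta>x z_def)
  moreover have "A = 0" if "map_matrix \<phi> A *v z = 0" for A :: "'k^'n^'n"
  proof -
    have "A $ i $ j = 0" for i j
    proof -
      \<comment> \<open>The linear form given by row i of A; its coefficient at the j-th selected
        indeterminate is the entry A_ij.\<close>
      define p where "p = (\<Sum>k\<in>UNIV. ?s (?s (e k) (1::nat)) (A $ i $ k))"
      have "\<iota> p = (\<Sum>k\<in>UNIV. \<phi> (A $ i $ k) * x (e k))"
        by (simp add: p_def \<iota>sum \<phi>_def x_def mult_single flip: hom(2))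
      also have "\<dots> = 0"
        using that by (simp add: vec_eq_iff matrix_vector_mult_def z_def)
      finally have "p = 0"
        by (rule \<iota>_eq_0)
      moreover have "?s (e k) (1::nat) = ?s (e j) 1 \<longleftrightarrow> k = j" for k
        using e by (metis injD lookup_single_eq lookup_single_not_eq zero_neq_one)
      then have "Poly_Mapping.lookup p (?s (e j) 1) = (\<Sum>k\<in>UNIV. if k = j then A $ i $ k else 0)"
        by (simp add: p_def lookup_sum lookup_single when_def)
      ultimately show ?thesis
        by simp
    qed
    then show ?thesis
      by (simp add: vec_eq_iff)
  qed
  ultimately show ?thesis
    using that zS by blast
qed

section \<open>The two implications for the matrix differential resultant\<close>

theorem theoremA:
  fixes d :: "'k::field_char_0 \<Rightarrow> 'k"
    and A\<^sub>0 A\<^sub>1 :: "'k^'n::finite^'n"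
    and P Q :: "('k, 'n) modo"
  assumes "derivation_on UNIV d"
    and "algebraically_closed_set (constants d)"
    and "P = [:A\<^sub>0, A\<^sub>1:]"
    and "invertible A\<^sub>1"
  shows "((\<exists>(\<phi> :: 'k \<Rightarrow> 'e::field) \<Sigma> \<delta> y.
              diff_field_extension d \<phi> \<Sigma> \<delta> \<and> nontrivial_common_solution \<phi> \<Sigma> \<delta> P Q y)
            \<longrightarrow> DRes d P Q = 0)
       \<and> (modo_mult d P Q = modo_mult d Q P \<and> DRes d P Q = 0
            \<longrightarrow> (\<exists>(\<phi> :: 'k \<Rightarrow> 'k universal_ext) \<Sigma> \<delta> \<psi>.
                  diff_field_extension d \<phi> \<Sigma> \<delta> \<and> finite_transcendence_degree \<phi> \<Sigma> \<and>
                  nontrivial_common_solution \<phi> \<Sigma> \<delta> P Q \<psi>))"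
proof -
  define N where "N = - (matrix_inv A\<^sub>1 ** A\<^sub>0)"
  define M where "M = modo_eval d N Q"
  have DRes: "DRes d P Q = det M"
    by (simp add: DRes_def M_matrix_def assms(3) M_def N_def modo_eval_def)
  note firstorder = modo_apply_first_order_eq_0_iff[OF _ assms(4) N_def]
  show ?thesis
    unfolding DRes
  proof (intro conjI impI)
    assume "\<exists>(\<phi> :: 'k \<Rightarrow> 'e) \<Sigma> \<delta> y.
      diff_field_extension d \<phi> \<Sigma> \<delta> \<and> nontrivial_common_solution \<phi> \<Sigma> \<delta> P Q y"
    then obtain \<phi> :: "'k \<Rightarrow> 'e" and \<Sigma> \<delta> and y :: "'e^'n"
      where ext: "diff_field_extension d \<phi> \<Sigma> \<delta>" and y: "\<And>i. y $ i \<in> \<Sigma>" "y \<noteq> 0"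
        and PQ: "modo_apply \<phi> \<delta> P y = 0" "modo_apply \<phi> \<delta> Q y = 0"
      unfolding nontrivial_common_solution_def by blast
    have "map_vector \<delta> y = map_matrix \<phi> N *v y"
      using PQ(1) firstorder[OF ext] by (simp add: assms(3))
    then have My: "map_matrix \<phi> M *v y = 0"
      using modo_apply_solution[OF ext y(1), of N Q] PQ(2) by (simp add: M_def)
    \<comment> \<open>Otherwise a left inverse of M would force y = 0.\<close>
    have "det (map_matrix \<phi> M) = 0"
    proof (rule ccontr)
      assume "det (map_matrix \<phi> M) \<noteq> 0"
      then obtain G where "G ** map_matrix \<phi> M = mat 1"
        by (metis invertible_def invertible_det_nz)
      then have "y = G *v (map_matrix \<phi> M *v y)"
        by (simp add: matrix_vector_mul_assoc)
      with My y(2) show False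
        by simp
    qed
    then show "det M = 0"
      by (simp add: det_map_matrix[OF ext] diff_field_extension_eq_0_iff[OF ext])
  next
    assume "modo_mult d P Q = modo_mult d Q P \<and> det M = 0"
    then have com: "modo_mult d [:A\<^sub>0, A\<^sub>1:] Q = modo_mult d Q [:A\<^sub>0, A\<^sub>1:]" and det: "det M = 0"
      by (simp_all add: assms(3))
    have M': "M ** N + map_matrix d M = N ** M"
      unfolding M_def by (rule commuting_first_order[OF assms(1,4) com N_def])
    obtain W where W: "W \<noteq> 0" "M ** W = 0" "\<And>Y :: 'k^'n^'n. M ** Y = 0 \<Longrightarrow> W ** Y = Y"
      using singular_kernel_projection[OF det] by blast
    define B where "B = map_matrix d W + - (N ** W)"
    \<comment> \<open>Differentiating M W = 0 gives M W' = -M' W, and the commutation identity times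
      W gives M N W = -M' W. Subtracting, M B = 0, so the columns of B lie in the kernel of M and W
      fixes them.\<close>
    have "map_matrix d M ** W + M ** map_matrix d W = 0"
      using map_matrix_derivation_mult[OF assms(1), of M W] W(2)
      by (simp add: map_matrix_derivation_0[OF assms(1)])
    moreover have "M ** N ** W + map_matrix d M ** W = 0"
      using arg_cong[OF M', of "\<lambda>Y. Y ** W"] W(2)
      by (simp add: matrix_add_mult_distrib flip: matrix_mul_assoc)
    ultimately have "M ** map_matrix d W = - (map_matrix d M ** W)"
      "M ** N ** W = - (map_matrix d M ** W)"
      by (simp_all add: eq_neg_iff_add_eq_0 add.commute)
    moreover have "M ** B = M ** map_matrix d W + - (M ** N ** W)"
      by (simp only: B_def matrix_add_ldistrib matrix_mult_minus matrix_mul_assoc)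
    ultimately have "M ** B = 0"
      by simp
    then have WB: "W ** B = B"
      by (rule W(3))
    obtain \<phi> :: "'k \<Rightarrow> 'k universal_ext" and \<Sigma> \<delta> and z :: "'k universal_ext^'n"
      where ext: "diff_field_extension d \<phi> \<Sigma> \<delta>" and fin: "finite_transcendence_degree \<phi> \<Sigma>"
        and z: "\<And>i. z $ i \<in> \<Sigma>" "map_vector \<delta> z = map_matrix \<phi> (- B) *v z"
        and indep: "\<And>A :: 'k^'n^'n. map_matrix \<phi> A *v z = 0 \<Longrightarrow> A = 0"
      using generic_solution[OF assms(1), of "- B"] by metis
    define \<psi> where "\<psi> = map_matrix \<phi> W *v z"
    have \<psi>S: "\<psi> $ i \<in> \<Sigma>" for i
      unfolding \<psi>_def by (rule diff_field_extension_matrix_vec_closed[OF ext z(1)])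
    \<comment> \<open>With z' = -B z and W B = B, the derivative of W z is (W' - B) z = N W
      z.\<close>
    have "map_vector \<delta> \<psi> = map_matrix \<phi> (map_matrix d W + W ** (- B)) *v z"
      unfolding \<psi>_def
      by (simp add: map_vector_matrix_vec[OF ext z(1)] z(2) diff_field_extension_mult_vec[OF ext]
          diff_field_extension_add_vec[OF ext])
    also have "map_matrix d W + W ** (- B) = N ** W"
      by (simp add: matrix_mult_minus WB) (simp add: B_def)
    finally have \<psi>': "map_vector \<delta> \<psi> = map_matrix \<phi> N *v \<psi>"
      by (simp add: \<psi>_def diff_field_extension_mult_vec[OF ext])
    have "modo_apply \<phi> \<delta> Q \<psi> = map_matrix \<phi> (M ** W) *v z"
      using modo_apply_solution[OF ext \<psi>S \<psi>', of Q]
      by (simp add: M_def \<psi>_def diff_field_extension_mult_vec[OF ext])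
    then have "modo_apply \<phi> \<delta> Q \<psi> = 0"
      by (simp add: W(2) diff_field_extension_zero_vec[OF ext])
    moreover have "modo_apply \<phi> \<delta> P \<psi> = 0"
      using \<psi>' firstorder[OF ext] by (simp add: assms(3))
    moreover have "\<psi> \<noteq> 0"
      using indep W(1) by (auto simp: \<psi>_def)
    ultimately show "\<exists>(\<phi> :: 'k \<Rightarrow> 'k universal_ext) \<Sigma> \<delta> \<psi>.
        diff_field_extension d \<phi> \<Sigma> \<delta> \<and> finite_transcendence_degree \<phi> \<Sigma> \<and>
        nontrivial_common_solution \<phi> \<Sigma> \<delta> P Q \<psi>"
      using ext fin \<psi>S unfolding nontrivial_common_solution_def by blast
  qed
qed

end
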